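(* Let $(\mathcal{A},\bullet_{\mathcal{A}},\omega_{\mathcal{A}})$ be a pre-symplectic left-symmetric algebra over $\mathbb{K}$. Let $\mathbb{K}d$ be a one-dimensional vector space and $\mathbb{K}e$ its dual. Let $\xi,D:\mathcal{A}\to\mathcal{A}$ be linear maps, $b_0\in\mathcal{A}$ and $\lambda\in\mathbb{K}$ such that $\xi$ is symmetric with respect to $\omega_{\mathcal{A}}$ and, for all $u,v\in\mathcal{A}$, $$\begin{aligned}&D([u,v]_{\bullet_{\mathcal{A}}})=0,\quad u\bullet_{\mathcal{A}}D(v)=v\bullet_{\mathcal{A}}D(u),\quad D(u)\bullet_{\mathcal{A}}v=\xi(u)\bullet_{\mathcal{A}}v,\quad \xi(u\bullet_{\mathcal{A}}v)=u\bullet_{\mathcal{A}}\xi(v),\\ &\xi\circ D=\lambda D+\mathrm{R}^{\bullet_{\mathcal{A}}}_{b_0},\quad D^2=D\circ\xi,\quad D^*\circ D=0,\quad D^*(b_0)=0.\end{aligned}$$ On $\overline{\mathcal{A}}:=\mathbb{K}d\oplus\mathcal{A}\oplus\mathbb{K}e$ define the bilinear product $\bullet$ by $$\begin{aligned}&e\bullet u=u\bullet e=e\bullet d=e\bullet e=0,\quad d\bullet e=\lambda e,\quad d\bullet u=\xi(u)-\omega_{\mathcal{A}}(b_0,u)e,\\ &u\bullet d=D(u),\quad d\bullet d=\lambda d+b_0,\quad u\bullet v=u\bullet_{\mathcal{A}}v-\omega_{\mathcal{A}}(D(u),v)e,\end{aligned}$$ for all $u,v\in\mathcal{A}$, and the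 skew-symmetric bilinear form $\omega$ by $\omega|_{\mathcal{A}\times\mathcal{A}}=\omega_{\mathcal{A}}$, $\omega(e,d)=-\omega(d,e)=1$, $\omega(d,\mathcal{A})=\omega(e,\mathcal{A})=\{0\}$. Then $(\overline{\mathcal{A}},\bullet,\omega)$ is a pre-symplectic left-symmetric algebra.
   Context: $\mathbb{K}$ is a field of characteristic $0$; all vector spaces are finite-dimensional. A pre-symplectic left-symmetric algebra is a triple $(\mathcal{A},\bullet,\omega)$ where $(u\bullet v)\bullet w-u\bullet(v\bullet w)=(v\bullet u)\bullet w-v\bullet(u\bullet w)$ for all $u,v,w$ (left-symmetry) and $\omega$ is a nondegenerate skew-symmetric bilinear form with $\omega(u\bullet v,w)=\omega(v,u\bullet w)$ for all $u,v,w$. $[u,v]_\bullet=u\bullet v-v\bullet u$; $\mathrm{R}^\bullet_b(u)=u\bullet b$. For $T\in\mathrm{End}(\mathcal{A})$, $T^*$ is its adjoint: $\omega_{\mathcal{A}}(Tx,y)=\omega_{\mathcal{A}}(x,T^*y)$; $T$ is symmetric if $T^*=T$. *)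

theory Defs
  imports "HOL-Analysis.Product_Vector"
begin

section \<open>Pre-symplectic left-symmetric algebras\<close>

definition bilinear_map ::
  "('k::field \<Rightarrow> 'a::ab_group_add \<Rightarrow> 'a) \<Rightarrow> ('k \<Rightarrow> 'b::ab_group_add \<Rightarrow> 'b) \<Rightarrow>
   ('k \<Rightarrow> 'c::ab_group_add \<Rightarrow> 'c) \<Rightarrow> ('a \<Rightarrow> 'b \<Rightarrow> 'c) \<Rightarrow> bool" where
  "bilinear_map s1 s2 s3 f \<longleftrightarrow>
     (\<forall>u. Vector_Spaces.linear s2 s3 (f u)) \<and> (\<forall>v. Vector_Spaces.linear s1 s3 (\<lambda>u. f u v))"

definition commutator :: "('v \<Rightarrow> 'v \<Rightarrow> 'v) \<Rightarrow> 'v \<Rightarrow> 'v \<Rightarrow> 'v::minus" where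
  "commutator mult u v = mult u v - mult v u"

definition right_mult :: "('v \<Rightarrow> 'v \<Rightarrow> 'v) \<Rightarrow> 'v \<Rightarrow> 'v \<Rightarrow> 'v" where
  "right_mult mult b u = mult u b"

locale left_symmetric_algebra = vector_space scale
  for scale :: "'k::field_char_0 \<Rightarrow> 'v::ab_group_add \<Rightarrow> 'v" +
  fixes mult :: "'v \<Rightarrow> 'v \<Rightarrow> 'v"  (infixl \<open>\<odot>\<close> 70)
  assumes finite_dimensional: "\<exists>B. finite_dimensional_vector_space scale B"
    and bilinear_mult: "bilinear_map scale scale scale (\<odot>)"
    and left_symmetric:
      "(u \<odot> v) \<odot> w - u \<odot> (v \<odot> w) = (v \<odot> u) \<odot> w - v \<odot> (u \<odot> w)"

locale pre_symplectic_lsa = left_symmetric_algebra scale mult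
  for scale :: "'k::field_char_0 \<Rightarrow> 'v::ab_group_add \<Rightarrow> 'v"
    and mult :: "'v \<Rightarrow> 'v \<Rightarrow> 'v"  (infixl \<open>\<odot>\<close> 70) +
  fixes form :: "'v \<Rightarrow> 'v \<Rightarrow> 'k"
  assumes bilinear_form: "bilinear_map scale scale (*) form"
    and skew: "form u v = - form v u"
    and nondegenerate: "(\<And>v. form u v = 0) \<Longrightarrow> u = 0"
    and form_mult: "form (u \<odot> v) w = form v (u \<odot> w)"

section \<open>The adjoint of an endomorphism\<close>

definition adjoint_wrt :: "('v \<Rightarrow> 'v \<Rightarrow> 'k) \<Rightarrow> ('v \<Rightarrow> 'v) \<Rightarrow> 'v \<Rightarrow> 'v" where
  "adjoint_wrt form T = (THE S. \<forall>x y. form (T x) y = form x (S y))"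

definition symmetric_wrt :: "('v \<Rightarrow> 'v \<Rightarrow> 'k) \<Rightarrow> ('v \<Rightarrow> 'v) \<Rightarrow> bool" where
  "symmetric_wrt form T \<longleftrightarrow> adjoint_wrt form T = T"

text \<open>The description in \<^const>\<open>adjoint_wrt\<close> is meaningful: the form is nondegenerate and the
  space is finite-dimensional, so exactly one such map exists.\<close>

context pre_symplectic_lsa
begin

lemma form_simps:
  "form (x + y) z = form x z + form y z" "form z (x + y) = form z x + form z y"
  "form (scale c x) z = c * form x z" "form z (scale c x) = c * form z x"
  using bilinear_form by (simp_all add: bilinear_map_def Vector_Spaces.linear_iff)

lemma form_zero [simp]: "form 0 z = 0" "form z 0 = 0"
  using form_simps(3)[of 0 0 z] form_simps(4)[of z 0 0] by auto

lemma form_diff: "form z (x - y) = form z x - form z y"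
  using form_simps(2)[of z "x - y" y] by (simp add: algebra_simps)

lemma form_eq_right:
  assumes "\<And>x. form x u = form x v"
  shows "u = v"
proof -
  have "form (u - v) x = 0" for x
    using assms skew[of "u - v" x] form_diff[of x u v] by simp
  then show ?thesis using nondegenerate[of "u - v"] by simp
qed

lemma form_represents:
  assumes "Vector_Spaces.linear scale (*) f"
  shows "\<exists>v. \<forall>x. f x = form x v"
proof -
  obtain B where "finite_dimensional_vector_space scale B"
    using finite_dimensional by blast
  then interpret fd: finite_dimensional_vector_space scale B .
  define P where "P g = (\<Sum>b\<in>B. scale (g b) b)" for g :: "'v \<Rightarrow> 'k"
  have P_inj: "g b = h b" if "P g = P h" "b \<in> B" for g h b
  proof -
    have "(\<Sum>b\<in>B. scale (g b - h b) b) = 0"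
      using that(1) by (simp add: P_def scale_left_diff_distrib sum_subtractf)
    then have "g b - h b = 0"
      using independentD[OF fd.independent_Basis fd.finite_Basis subset_refl, of "\<lambda>b. g b - h b"] that(2)
      by blast
    then show ?thesis by simp
  qed
  have ext: "g x = h x"
    if "Vector_Spaces.linear scale (*) g" "Vector_Spaces.linear scale (*) h"
      and "\<And>b. b \<in> B \<Longrightarrow> g b = h b" for g h :: "'v \<Rightarrow> 'k" and x
  proof -
    interpret vp: vector_space_pair scale "(*) :: 'k \<Rightarrow> 'k \<Rightarrow> 'k"
      using that(1) by (simp add: Vector_Spaces.linear_iff vector_space_pair_def)
    show ?thesis
      using vp.linear_eq_on[OF that(1,2), of x B] that(3) fd.span_Basis by simp
  qed
  have lin: "Vector_Spaces.linear scale scale (\<lambda>v. P (\<lambda>b. form b v))"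
    unfolding Vector_Spaces.linear_iff
    by (simp add: vector_space_axioms P_def form_simps scale_left_distrib sum.distrib scale_sum_right)
  have "inj (\<lambda>v. P (\<lambda>b. form b v))"
  proof (rule injI)
    fix u v assume "P (\<lambda>b. form b u) = P (\<lambda>b. form b v)"
    then have "form b u = form b v" if "b \<in> B" for b
      using P_inj that by blast
    then have "form x u = form x v" for x
      using ext[of "\<lambda>x. form x u" "\<lambda>x. form x v"] bilinear_form
      by (simp add: bilinear_map_def)
    then show "u = v" by (rule form_eq_right)
  qed
  then have "surj (\<lambda>v. P (\<lambda>b. form b v))"
    by (rule fd.linear_inj_imp_surj[OF lin])
  then obtain v where "P f = P (\<lambda>b. form b v)" by (auto simp: surj_def)
  then have "f b = form b v" if "b \<in> B" for b
    using P_inj that by blast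
  then have "f x = form x v" for x
    using ext[OF assms, of "\<lambda>x. form x v"] bilinear_form by (simp add: bilinear_map_def)
  then show ?thesis by blast
qed

lemma adjoint_wrt_eqI:
  assumes "\<And>x y. form (T x) y = form x (S y)"
  shows "adjoint_wrt form T = S"
  unfolding adjoint_wrt_def
proof (rule the_equality)
  fix S' assume "\<forall>x y. form (T x) y = form x (S' y)"
  then have "form x (S' y) = form x (S y)" for x y
    using assms by metis
  then show "S' = S" using form_eq_right by blast
qed (use assms in blast)

lemma adjoint_wrt_works:
  assumes "Vector_Spaces.linear scale scale T"
  shows "form (T x) y = form x (adjoint_wrt form T y)"
proof -
  have "Vector_Spaces.linear scale (*) (\<lambda>x. form (T x) y)" for y
    using assms bilinear_form by (simp add: bilinear_map_def Vector_Spaces.linear_iff)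
  then have "\<forall>y. \<exists>v. \<forall>x. form (T x) y = form x v"
    using form_represents by blast
  then obtain S where "\<And>x y. form (T x) y = form x (S y)" by metis
  with adjoint_wrt_eqI[of T S] show ?thesis by simp
qed

end

section \<open>The extension by a hyperbolic plane\<close>

text \<open>A triple \<open>(a, u, b)\<close> stands for \<open>a d + u + b e\<close>.\<close>

abbreviation ext_scale ::
  "('k::field \<Rightarrow> 'v::ab_group_add \<Rightarrow> 'v) \<Rightarrow> 'k \<Rightarrow> 'k \<times> 'v \<times> 'k \<Rightarrow> 'k \<times> 'v \<times> 'k" where
  "ext_scale s \<equiv> module_prod.scale (*) (module_prod.scale s (*))"

definition ext_d :: "'k::field \<times> 'v::ab_group_add \<times> 'k" where "ext_d = (1, 0, 0)"
definition ext_e :: "'k::field \<times> 'v::ab_group_add \<times> 'k" where "ext_e = (0, 0, 1)"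
definition ext_in :: "'v::ab_group_add \<Rightarrow> 'k::field \<times> 'v \<times> 'k" where "ext_in u = (0, u, 0)"

definition ext_mult ::
  "('k::field \<Rightarrow> 'v::ab_group_add \<Rightarrow> 'v) \<Rightarrow> ('v \<Rightarrow> 'v \<Rightarrow> 'v) \<Rightarrow> ('v \<Rightarrow> 'v \<Rightarrow> 'k) \<Rightarrow>
   ('v \<Rightarrow> 'v) \<Rightarrow> ('v \<Rightarrow> 'v) \<Rightarrow> 'v \<Rightarrow> 'k \<Rightarrow> 'k \<times> 'v \<times> 'k \<Rightarrow> 'k \<times> 'v \<times> 'k \<Rightarrow> 'k \<times> 'v \<times> 'k" where
  "ext_mult s mult form \<xi> D b0 l = (\<lambda>(a, u, b) (a', u', b').
     (a * a' * l,
      s (a * a') b0 + s a (\<xi> u') + s a' (D u) + mult u u',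
      a * b' * l - a * form b0 u' - form (D u) u'))"

definition ext_form ::
  "('v \<Rightarrow> 'v \<Rightarrow> 'k::field) \<Rightarrow> 'k \<times> 'v \<times> 'k \<Rightarrow> 'k \<times> 'v \<times> 'k \<Rightarrow> 'k" where
  "ext_form form = (\<lambda>(a, u, b) (a', u', b'). form u u' + b * a' - a * b')"

text \<open>The two closed formulas are the bilinear extensions of the following tables, and the only
  ones.\<close>

definition ext_mult_table ::
  "('k::field \<Rightarrow> 'v::ab_group_add \<Rightarrow> 'v) \<Rightarrow> ('v \<Rightarrow> 'v \<Rightarrow> 'v) \<Rightarrow> ('v \<Rightarrow> 'v \<Rightarrow> 'k) \<Rightarrow>
   ('v \<Rightarrow> 'v) \<Rightarrow> ('v \<Rightarrow> 'v) \<Rightarrow> 'v \<Rightarrow> 'k \<Rightarrow>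
   ('k \<times> 'v \<times> 'k \<Rightarrow> 'k \<times> 'v \<times> 'k \<Rightarrow> 'k \<times> 'v \<times> 'k) \<Rightarrow> bool" where
  "ext_mult_table s mult form \<xi> D b0 l m \<longleftrightarrow>
     (\<forall>u. m ext_e (ext_in u) = 0 \<and> m (ext_in u) ext_e = 0) \<and>
     m ext_e ext_d = 0 \<and> m ext_e ext_e = 0 \<and>
     m ext_d ext_e = ext_scale s l ext_e \<and>
     (\<forall>u. m ext_d (ext_in u) = ext_in (\<xi> u) - ext_scale s (form b0 u) ext_e) \<and>
     (\<forall>u. m (ext_in u) ext_d = ext_in (D u)) \<and>
     m ext_d ext_d = ext_scale s l ext_d + ext_in b0 \<and>
     (\<forall>u v. m (ext_in u) (ext_in v) =
        ext_in (mult u v) - ext_scale s (form (D u) v) ext_e)"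

definition ext_form_table ::
  "('v::ab_group_add \<Rightarrow> 'v \<Rightarrow> 'k::field) \<Rightarrow> ('k \<times> 'v \<times> 'k \<Rightarrow> 'k \<times> 'v \<times> 'k \<Rightarrow> 'k) \<Rightarrow> bool" where
  "ext_form_table form w \<longleftrightarrow>
     (\<forall>x y. w x y = - w y x) \<and>
     (\<forall>u v. w (ext_in u) (ext_in v) = form u v) \<and>
     w ext_e ext_d = 1 \<and> w ext_d ext_e = - 1 \<and>
     (\<forall>u. w ext_d (ext_in u) = 0 \<and> w ext_e (ext_in u) = 0)"

context pre_symplectic_lsa
begin

lemma vector_space_field: "vector_space ((*) :: 'k \<Rightarrow> 'k \<Rightarrow> 'k)"
  by unfold_locales (simp_all add: algebra_simps)

lemma ext_scale_apply: "ext_scale scale c (a, u, b) = (c * a, scale c u, c * b)"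
proof -
  interpret f: vector_space "(*) :: 'k \<Rightarrow> 'k \<Rightarrow> 'k" by (rule vector_space_field)
  interpret p: module_prod scale "(*) :: 'k \<Rightarrow> 'k \<Rightarrow> 'k" by unfold_locales
  interpret q: module_prod "(*) :: 'k \<Rightarrow> 'k \<Rightarrow> 'k" p.scale by unfold_locales
  show ?thesis by (simp add: q.scale_prod p.scale_prod)
qed

lemma vector_space_ext_scale: "vector_space (ext_scale scale)"
proof -
  interpret f: vector_space "(*) :: 'k \<Rightarrow> 'k \<Rightarrow> 'k" by (rule vector_space_field)
  interpret p: vector_space_prod scale "(*) :: 'k \<Rightarrow> 'k \<Rightarrow> 'k" by unfold_locales
  interpret q: vector_space_prod "(*) :: 'k \<Rightarrow> 'k \<Rightarrow> 'k" p.scale by unfold_locales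
  show ?thesis by (rule q.p.vector_space_axioms)
qed

lemma mult_simps:
  "(x + y) \<odot> z = x \<odot> z + y \<odot> z" "z \<odot> (x + y) = z \<odot> x + z \<odot> y"
  "scale c x \<odot> z = scale c (x \<odot> z)" "z \<odot> scale c x = scale c (z \<odot> x)"
  using bilinear_mult by (simp_all add: bilinear_map_def Vector_Spaces.linear_iff)

lemma mult_zero [simp]: "0 \<odot> z = 0" "z \<odot> 0 = 0"
  using mult_simps(3)[of 0 0 z] mult_simps(4)[of z 0 0] by auto

lemma ext_decomp:
  "(a, u, b) = ext_scale scale a ext_d + (ext_in u + ext_scale scale b ext_e)"
  by (simp add: ext_d_def ext_e_def ext_in_def ext_scale_apply)

lemma ext_mult_bilinear:
  assumes "Vector_Spaces.linear scale scale \<xi>" "Vector_Spaces.linear scale scale D"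
  shows "bilinear_map (ext_scale scale) (ext_scale scale) (ext_scale scale)
           (ext_mult scale (\<odot>) form \<xi> D b0 l)"
proof -
  have lin: "\<xi> (x + y) = \<xi> x + \<xi> y" "\<xi> (scale c x) = scale c (\<xi> x)"
    "D (x + y) = D x + D y" "D (scale c x) = scale c (D x)" for c x y
    using assms unfolding Vector_Spaces.linear_iff by blast+
  let ?m = "ext_mult scale (\<odot>) form \<xi> D b0 l"
  note S = ext_scale_apply ext_mult_def lin form_simps mult_simps
  have "?m (x + y) z = ?m x z + ?m y z" for x y z
    by (cases x; cases y; cases z) (simp add: S scale_left_distrib scale_right_distrib
        ring_distribs add_ac mult_ac)
  moreover have "?m z (x + y) = ?m z x + ?m z y" for x y z
    by (cases x; cases y; cases z) (simp add: S scale_left_distrib scale_right_distrib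
        ring_distribs add_ac mult_ac)
  moreover have "?m (ext_scale scale c x) z = ext_scale scale c (?m x z)" for c x z
    by (cases x; cases z) (simp add: S scale_left_distrib scale_right_distrib
        ring_distribs add_ac mult_ac)
  moreover have "?m z (ext_scale scale c x) = ext_scale scale c (?m z x)" for c x z
    by (cases x; cases z) (simp add: S scale_left_distrib scale_right_distrib
        ring_distribs add_ac mult_ac)
  ultimately show ?thesis
    unfolding bilinear_map_def Vector_Spaces.linear_iff
    using vector_space_ext_scale by blast
qed

lemma ext_mult_table:
  assumes "Vector_Spaces.linear scale scale \<xi>" "Vector_Spaces.linear scale scale D"
  shows "ext_mult_table scale (\<odot>) form \<xi> D b0 l (ext_mult scale (\<odot>) form \<xi> D b0 l)"
proof -
  have "\<xi> 0 = 0" "D 0 = 0"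
    using assms by (metis Vector_Spaces.linear_iff add_cancel_right_right)+
  then show ?thesis
    by (simp add: ext_mult_table_def ext_mult_def ext_d_def ext_e_def ext_in_def
        ext_scale_apply zero_prod_def)
qed

lemma ext_mult_unique:
  assumes "bilinear_map (ext_scale scale) (ext_scale scale) (ext_scale scale) m"
    and "ext_mult_table scale (\<odot>) form \<xi> D b0 l m"
  shows "m = ext_mult scale (\<odot>) form \<xi> D b0 l"
proof (intro ext)
  have bil: "m (x + y) z = m x z + m y z" "m z (x + y) = m z x + m z y"
    "m (ext_scale scale c x) z = ext_scale scale c (m x z)"
    "m z (ext_scale scale c x) = ext_scale scale c (m z x)" for c x y z
    using assms(1) unfolding bilinear_map_def Vector_Spaces.linear_iff by blast+
  interpret E: vector_space "ext_scale scale" by (rule vector_space_ext_scale)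
  have sc: "ext_scale scale c 0 = 0"
    "ext_scale scale c (x + y) = ext_scale scale c x + ext_scale scale c y" for c x y
    by (rule E.scale_zero_right, rule E.scale_right_distrib)
  fix x y :: "'k \<times> 'v \<times> 'k"
  obtain a u b where x: "x = (a, u, b)" by (cases x)
  obtain a' u' b' where y: "y = (a', u', b')" by (cases y)
  let ?d = "ext_scale scale a ext_d" and ?e = "ext_scale scale b ext_e"
  let ?d' = "ext_scale scale a' ext_d" and ?e' = "ext_scale scale b' ext_e"
  have "m x y = m (?d + (ext_in u + ?e)) (?d' + (ext_in u' + ?e'))"
    by (simp only: x y ext_decomp[symmetric])
  also have "\<dots> = ext_scale scale a (ext_scale scale a' (ext_scale scale l ext_d + ext_in b0))
      + ext_scale scale a (ext_in (\<xi> u') - ext_scale scale (form b0 u') ext_e)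
      + ext_scale scale a (ext_scale scale b' (ext_scale scale l ext_e))
      + ext_scale scale a' (ext_in (D u))
      + (ext_in (u \<odot> u') - ext_scale scale (form (D u) u') ext_e)"
    using assms(2) unfolding ext_mult_table_def
    by (simp only: bil) (simp add: ac_simps sc)
  also have "\<dots> = ext_mult scale (\<odot>) form \<xi> D b0 l x y"
    unfolding x y
    by (simp add: ext_mult_def ext_d_def ext_e_def ext_in_def ext_scale_apply algebra_simps)
  finally show "m x y = ext_mult scale (\<odot>) form \<xi> D b0 l x y" .
qed

lemma ext_form_bilinear: "bilinear_map (ext_scale scale) (ext_scale scale) (*) (ext_form form)"
proof -
  note S = ext_scale_apply ext_form_def form_simps
  have "ext_form form (x + y) z = ext_form form x z + ext_form form y z" for x y z
    by (cases x; cases y; cases z) (simp add: S algebra_simps)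
  moreover have "ext_form form z (x + y) = ext_form form z x + ext_form form z y" for x y z
    by (cases x; cases y; cases z) (simp add: S algebra_simps)
  moreover have "ext_form form (ext_scale scale c x) z = c * ext_form form x z" for c x z
    by (cases x; cases z) (simp add: S algebra_simps)
  moreover have "ext_form form z (ext_scale scale c x) = c * ext_form form z x" for c x z
    by (cases x; cases z) (simp add: S algebra_simps)
  ultimately show ?thesis
    unfolding bilinear_map_def Vector_Spaces.linear_iff
    using vector_space_ext_scale vector_space_field by blast
qed

lemma ext_form_table: "ext_form_table form (ext_form form)"
proof -
  have anti: "ext_form form x y = - ext_form form y x" for x y
    using skew[of "fst (snd x)" "fst (snd y)"] by (simp add: ext_form_def case_prod_beta mult.commute)
  show ?thesis
    unfolding ext_form_table_def
    by (intro conjI allI) (rule anti | simp add: ext_form_def ext_d_def ext_e_def ext_in_def)+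
qed

lemma ext_form_unique:
  assumes "bilinear_map (ext_scale scale) (ext_scale scale) (*) w"
    and "ext_form_table form w"
  shows "w = ext_form form"
proof (intro ext)
  have bil: "w (x + y) z = w x z + w y z" "w z (x + y) = w z x + w z y"
    "w (ext_scale scale c x) z = c * w x z"
    "w z (ext_scale scale c x) = c * w z x" for c x y z
    using assms(1) unfolding bilinear_map_def Vector_Spaces.linear_iff by blast+
  have swap: "w x y = - w y x" for x y
    using assms(2) unfolding ext_form_table_def by blast
  have diag: "w x x = 0" for x
  proof -
    have "2 * w x x = 0" using swap[of x x] by (metis add.right_inverse mult_2)
    then show ?thesis by simp
  qed
  have tab: "w (ext_in u) (ext_in v) = form u v" "w ext_e ext_d = 1" "w ext_d ext_e = - 1"
    "w ext_d (ext_in u) = 0" "w ext_e (ext_in u) = 0" for u v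
    using assms(2) unfolding ext_form_table_def by blast+
  have in_left: "w (ext_in u) ext_d = 0" "w (ext_in u) ext_e = 0" for u
    using swap[of "ext_in u"] tab by simp_all
  fix x y :: "'k \<times> 'v \<times> 'k"
  obtain a u b where x: "x = (a, u, b)" by (cases x)
  obtain a' u' b' where y: "y = (a', u', b')" by (cases y)
  have "w x y = form u u' + b * a' - a * b'"
    unfolding x y ext_decomp[of a] ext_decomp[of a'] bil by (simp add: tab diag in_left)
  then show "w x y = ext_form form x y" by (simp add: x y ext_form_def)
qed

end

end

theory Submission
  imports Defs
begin

text \<open>
  Everything except left-symmetry is bookkeeping. The extended form is the orthogonal sum of
  \<open>\<omega>\<close> and a hyperbolic plane, hence skew and nondegenerate. Since \<open>\<xi>\<close> is symmetric, the
  \<open>e\<close>-components of the new product are exactly the correction terms that make every left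
  multiplication self-adjoint: \<open>- \<omega> (D u) v\<close> in \<open>u \<bullet> v\<close> answers to \<open>u \<bullet> d = D u\<close>,
  \<open>- \<omega> b0 u\<close> in \<open>d \<bullet> u\<close> to the component \<open>b0\<close> of \<open>d \<bullet> d\<close>, and \<open>d \<bullet> e = \<lambda> e\<close> to the
  component \<open>\<lambda> d\<close> of \<open>d \<bullet> d\<close>.

  Left-symmetry says that the associator \<open>(x, y, z) = (x \<bullet> y) \<bullet> z - x \<bullet> (y \<bullet> z)\<close> is symmetric
  in \<open>x\<close> and \<open>y\<close>. By trilinearity the arguments may be taken from \<open>d\<close>, \<open>e\<close> and the algebra, and
  associators containing \<open>e\<close> vanish. What remains, split into components along the algebra and
  along \<open>e\<close>, is:
  \<^item> \<open>(u, v, w)\<close> is symmetric in \<open>u\<close>, \<open>v\<close>: left-symmetry of the given product; along \<open>e\<close>, the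
    symmetry of \<open>\<omega> (D u) (v \<odot> w) = \<omega> (v \<odot> D u) w\<close> and the vanishing of \<open>D\<close> on commutators.
  \<^item> \<open>(u, v, d)\<close> is symmetric in \<open>u\<close>, \<open>v\<close>: both \<open>D (u \<odot> v)\<close> and \<open>u \<odot> D v\<close> are; along \<open>e\<close>, the
    range of \<open>D\<close> is isotropic, which is the content of \<open>D\<^sup>* \<circ> D = 0\<close>.
  \<^item> \<open>(d, u, v) = (u, d, v)\<close>: \<open>\<xi> u \<odot> v = D u \<odot> v\<close> and \<open>\<xi> (u \<odot> v) = u \<odot> \<xi> v\<close>; along \<open>e\<close>,
    \<open>D \<circ> \<xi> = D\<^sup>2\<close> and \<open>\<omega> (D u) (\<xi> v) = \<omega> (\<xi> (D u)) v\<close>, expanded by the formula for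
    \<open>\<xi> \<circ> D\<close>.
  \<^item> \<open>(d, u, d) = (u, d, d)\<close>: \<open>D (\<xi> u) - \<xi> (D u) = D\<^sup>2 u - \<lambda> D u - u \<odot> b0\<close>; along \<open>e\<close>, \<open>b0\<close> is
    orthogonal to the range of \<open>D\<close>, which is the content of \<open>D\<^sup>* b0 = 0\<close>.
\<close>

context pre_symplectic_lsa
begin

lemma finite_dimensional_ext_scale:
  assumes "finite_dimensional_vector_space scale B"
  shows "\<exists>C. finite_dimensional_vector_space (ext_scale scale) C"
proof -
  interpret V: finite_dimensional_vector_space scale B by fact
  interpret K: vector_space "(*) :: 'k \<Rightarrow> 'k \<Rightarrow> 'k" by (rule vector_space_field)
  interpret K: finite_dimensional_vector_space "(*) :: 'k \<Rightarrow> 'k \<Rightarrow> 'k" "{1}"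
  proof
    show "K.span {1} = UNIV"
      by (auto simp: K.span_singleton)
  qed simp_all
  interpret P: finite_dimensional_vector_space_prod scale "(*) :: 'k \<Rightarrow> 'k \<Rightarrow> 'k" B "{1}"
    by unfold_locales
  interpret Q: finite_dimensional_vector_space_prod "(*) :: 'k \<Rightarrow> 'k \<Rightarrow> 'k" P.scale "{1}" P.Basis_pair
    by unfold_locales
  show ?thesis using Q.p.finite_dimensional_vector_space_axioms by blast
qed

text \<open>Each coordinate of \<open>x\<close> is read off by pairing with the dual summand: the \<open>e\<close>-coordinate by
  \<open>d\<close>, the \<open>d\<close>-coordinate by \<open>e\<close>, and the middle one by the algebra itself.\<close>

lemma ext_form_nondegenerate:
  assumes "\<And>y. ext_form form x y = 0"
  shows "x = 0"
proof -
  obtain a u p where x: "x = (a, u, p)" by (cases x)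
  have "p = 0" using assms[of "(1, 0, 0)"] by (simp add: x ext_form_def)
  moreover have "a = 0" using assms[of "(0, 0, 1)"] by (simp add: x ext_form_def)
  moreover have "form u v = 0" for v using assms[of "(0, v, 0)"] by (simp add: x ext_form_def)
  then have "u = 0" by (rule nondegenerate)
  ultimately show ?thesis by (simp add: x zero_prod_def)
qed

end

text \<open>The conditions on \<open>(\<xi>, D, b0, l)\<close> in pointwise form: the three hypotheses on adjoints
  become statements about values of the form, which is how the computation uses them.\<close>

locale extension_data = pre_symplectic_lsa scale mult form
  for scale :: "'k::field_char_0 \<Rightarrow> 'v::ab_group_add \<Rightarrow> 'v"
    and mult :: "'v \<Rightarrow> 'v \<Rightarrow> 'v"  (infixl \<open>\<odot>\<close> 70)
    and form :: "'v \<Rightarrow> 'v \<Rightarrow> 'k" +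
  fixes \<xi> D :: "'v \<Rightarrow> 'v" and b0 :: 'v and l :: 'k
  assumes linear_xi: "Vector_Spaces.linear scale scale \<xi>"
    and linear_D: "Vector_Spaces.linear scale scale D"
    and xi_symmetric: "form (\<xi> u) v = form u (\<xi> v)"
    and D_mult_commute: "D (u \<odot> v) = D (v \<odot> u)"
    and mult_D_commute: "u \<odot> D v = v \<odot> D u"
    and D_mult_eq_xi_mult: "D u \<odot> v = \<xi> u \<odot> v"
    and xi_mult: "\<xi> (u \<odot> v) = u \<odot> \<xi> v"
    and xi_D: "\<xi> (D u) = scale l (D u) + u \<odot> b0"
    and D_D: "D (D u) = D (\<xi> u)"
    and range_D_isotropic: "form (D u) (D v) = 0"
    and range_D_orthogonal_b0: "form (D u) b0 = 0"
begin

abbreviation extended_mult (infixl \<open>\<odot>\<odot>\<close> 70) where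
  "x \<odot>\<odot> y \<equiv> ext_mult scale (\<odot>) form \<xi> D b0 l x y"

lemma xi_D_simps:
  "\<xi> (x + y) = \<xi> x + \<xi> y" "\<xi> (scale c x) = scale c (\<xi> x)"
  "D (x + y) = D x + D y" "D (scale c x) = scale c (D x)"
  using linear_xi linear_D unfolding Vector_Spaces.linear_iff by blast+

text \<open>Moving \<open>v\<close> across the form turns this into the symmetry of \<open>v \<odot> D u\<close>.\<close>

lemma form_D_mult_commute: "form (D u) (v \<odot> w) = form (D v) (u \<odot> w)"
  using form_mult[of v "D u" w] form_mult[of u "D v" w] mult_D_commute[of u v] by simp

lemma range_D_orthogonal_b0': "form b0 (D u) = 0"
  using skew[of b0 "D u"] range_D_orthogonal_b0 by simp

text \<open>This is what makes the \<open>e\<close>-components of \<open>(d, u, v)\<close> and \<open>(u, d, v)\<close> agree.\<close>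

lemma form_D_xi: "form (D u) (\<xi> v) = l * form (D u) v + form b0 (u \<odot> v)"
  using xi_symmetric[of "D u" v] form_mult[of u b0 v] by (simp add: xi_D form_simps)

lemma ext_form_mult:
  "ext_form form (x \<odot>\<odot> y) z = ext_form form y (x \<odot>\<odot> z)"
proof -
  obtain a u p where x: "x = (a, u, p)" by (cases x)
  obtain a' v q where y: "y = (a', v, q)" by (cases y)
  obtain a'' w r where z: "z = (a'', w, r)" by (cases z)
  show ?thesis
    using form_mult[of u v w] xi_symmetric[of v w] skew[of v b0] skew[of v "D u"]
    by (simp add: x y z ext_mult_def ext_form_def form_simps algebra_simps)
qed

text \<open>The associator in coordinates, arranged so that exchanging the first two arguments
  only exchanges matching terms: the identities of the data have already been used to bring the
  coefficient of each mixed pair into the shape of its mirror image.\<close>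

lemma ext_associator:
  "((a, u, p) \<odot>\<odot> (a', v, q)) \<odot>\<odot> (a'', w, r) - (a, u, p) \<odot>\<odot> ((a', v, q) \<odot>\<odot> (a'', w, r)) =
    (0,
     scale (a * a') (scale l (\<xi> w) + scale a'' (D b0 - \<xi> b0) + b0 \<odot> w - \<xi> (\<xi> w))
       + scale (a'' * a) (D (\<xi> v) - \<xi> (D v)) + scale (a'' * a') (D (\<xi> u) - \<xi> (D u))
       + scale a (\<xi> v \<odot> w - v \<odot> \<xi> w) + scale a' (\<xi> u \<odot> w - u \<odot> \<xi> w)
       + scale a'' (D (u \<odot> v) - u \<odot> D v)
       + ((u \<odot> v) \<odot> w - u \<odot> (v \<odot> w)),
     a * a' * (form b0 (\<xi> w) + a'' * form b0 b0 - form (D b0) w)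
       + a * (form (D v) (\<xi> w) - form (D (\<xi> v)) w)
       + a' * (form (D u) (\<xi> w) - form (D (\<xi> u)) w)
       + (form (D u) (v \<odot> w) - form (D (u \<odot> v)) w))"
  by (simp add: ext_mult_def form_simps form_diff mult_simps xi_D_simps xi_mult D_mult_eq_xi_mult
      xi_D D_D range_D_isotropic range_D_orthogonal_b0 range_D_orthogonal_b0' form_D_xi algebra_simps)

lemma ext_left_symmetric:
  "(x \<odot>\<odot> y) \<odot>\<odot> z - x \<odot>\<odot> (y \<odot>\<odot> z) = (y \<odot>\<odot> x) \<odot>\<odot> z - y \<odot>\<odot> (x \<odot>\<odot> z)"
proof -
  obtain a u p where x: "x = (a, u, p)" by (cases x)
  obtain a' v q where y: "y = (a', v, q)" by (cases y)
  obtain a'' w r where z: "z = (a'', w, r)" by (cases z)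
  show ?thesis
    unfolding x y z ext_associator
    using left_symmetric[of u v w] D_mult_commute[of u v] mult_D_commute[of u v]
      form_D_mult_commute[of u v w]
    by (simp add: ac_simps)
qed

lemma pre_symplectic_lsa_extension:
  "pre_symplectic_lsa (ext_scale scale) (\<odot>\<odot>) (ext_form form)"
proof -
  interpret E: vector_space "ext_scale scale" by (rule vector_space_ext_scale)
  show ?thesis
  proof unfold_locales
    show "\<exists>B. finite_dimensional_vector_space (ext_scale scale) B"
      using finite_dimensional finite_dimensional_ext_scale by blast
    show "bilinear_map (ext_scale scale) (ext_scale scale) (ext_scale scale) (\<odot>\<odot>)"
      by (rule ext_mult_bilinear[OF linear_xi linear_D])
    show "bilinear_map (ext_scale scale) (ext_scale scale) (*) (ext_form form)"
      by (rule ext_form_bilinear)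
    show "ext_form form x y = - ext_form form y x" for x y
      using ext_form_table unfolding ext_form_table_def by blast
    show "x = 0" if "\<And>y. ext_form form x y = 0" for x
      using that by (rule ext_form_nondegenerate)
  qed (rule ext_left_symmetric ext_form_mult)+
qed

end

theorem theorem5p1p1:
  fixes scale :: "'k::field_char_0 \<Rightarrow> 'v::ab_group_add \<Rightarrow> 'v"
    and mult :: "'v \<Rightarrow> 'v \<Rightarrow> 'v"  (infixl \<open>\<odot>\<close> 70)
    and \<omega> :: "'v \<Rightarrow> 'v \<Rightarrow> 'k"
    and \<xi> D :: "'v \<Rightarrow> 'v" and b0 :: 'v and l :: 'k
  assumes "pre_symplectic_lsa scale (\<odot>) \<omega>"
    and "Vector_Spaces.linear scale scale \<xi>"
    and "Vector_Spaces.linear scale scale D"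
    and "symmetric_wrt \<omega> \<xi>"
    and "\<And>u v. D (commutator (\<odot>) u v) = 0"
    and "\<And>u v. u \<odot> D v = v \<odot> D u"
    and "\<And>u v. D u \<odot> v = \<xi> u \<odot> v"
    and "\<And>u v. \<xi> (u \<odot> v) = u \<odot> \<xi> v"
    and "\<xi> \<circ> D = (\<lambda>u. scale l (D u) + right_mult (\<odot>) b0 u)"
    and "D \<circ> D = D \<circ> \<xi>"
    and "adjoint_wrt \<omega> D \<circ> D = (\<lambda>u. 0)"
    and "adjoint_wrt \<omega> D b0 = 0"
  shows "pre_symplectic_lsa (ext_scale scale)
           (ext_mult scale (\<odot>) \<omega> \<xi> D b0 l) (ext_form \<omega>)"
proof -
  interpret pre_symplectic_lsa scale "(\<odot>)" \<omega> by fact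
  have form_D: "\<omega> (D u) v = \<omega> u (adjoint_wrt \<omega> D v)" for u v
    using assms(3) by (rule adjoint_wrt_works)
  interpret extension_data scale "(\<odot>)" \<omega> \<xi> D b0 l
  proof (intro extension_data.intro extension_data_axioms.intro)
    show "\<omega> (\<xi> u) v = \<omega> u (\<xi> v)" for u v
      using adjoint_wrt_works[OF assms(2)] assms(4) by (simp add: symmetric_wrt_def)
    show "D (u \<odot> v) = D (v \<odot> u)" for u v
    proof -
      have "D (u \<odot> v) = D (commutator (\<odot>) u v + v \<odot> u)"
        by (simp add: commutator_def)
      also have "\<dots> = D (commutator (\<odot>) u v) + D (v \<odot> u)"
        using assms(3) unfolding Vector_Spaces.linear_iff by blast
      finally show ?thesis by (simp add: assms(5))
    qed
    show "\<xi> (D u) = scale l (D u) + u \<odot> b0" for u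
      using fun_cong[OF assms(9), of u] by (simp add: right_mult_def)
    show "D (D u) = D (\<xi> u)" for u
      using fun_cong[OF assms(10), of u] by simp
    show "\<omega> (D u) (D v) = 0" for u v
      using fun_cong[OF assms(11), of v] by (simp add: form_D)
    show "\<omega> (D u) b0 = 0" for u
      by (simp add: form_D assms(12))
  qed (fact assms)+
  show ?thesis by (rule pre_symplectic_lsa_extension)
qed

end
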